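(* Let $F\in\mathbf N_{-\infty}$ be nonrational with asymptotic coefficients $\{s_j\}_{j\ge0}$, let $J$ be the monic Jacobi matrix associated with $F$, let $\{\mathfrak n_j\}_{j=1}^\infty$ be the normal indices of the sequence $\mathfrak s=\{\mathfrak s_j\}_{j\ge 0}:=\{s_{j+1}\}_{j\ge 0}$, put $\mathfrak n_0=0$ and $\mathfrak k_j:=\mathfrak n_{j+1}-\mathfrak n_j$, $j\in\mathbb Z_+$. Then $J$ admits a factorization $J=LU$, where $$L=\begin{pmatrix} I_{\mathfrak k_0}&0&&\\ L_1&I_{\mathfrak k_1}&0&\\ &L_2&I_{\mathfrak k_2}&\ddots\\ &&\ddots&\ddots\end{pmatrix},\qquad U=\begin{pmatrix} U_0&D_0&&\\ 0&U_1&D_1&\\ &0&U_2&\ddots\\ &&\ddots&\ddots\end{pmatrix}$$ are block lower and block upper triangular matrices in which: $L_{j+1}$ is the $\mathfrak k_{j+1}\times\mathfrak k_j$ matrix whose upper-left entry is a number $l_{j+1}$ and whose other entries are $0$; $U_j=u_0^{(j)}$ if $\mathfrak k_j=1$ and $U_j=\begin{pmatrix}0&1\\ u_0^{(j)}&u_1^{(j)}\end{pmatrix}$ if $\mathfrak k_j=2$; and $D_j$ is the $\mathfrak k_j\times\mathfrak k_{j+1}$ matrix whose lower-left entry is $1$ and whose other entries are $0$. Moreover, this factorization is unique, and $$u_0^{(j)}=-\frac{P_{\mathfrak n_{j+1}}(0)}{P_{\mathfrak n_j}(0)},\qquad u_1^{(j)}=b_{\mathfrak n_j+1},\qquad j\in\mathbb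 Z_+$$ (the second relation for those $j$ with $\mathfrak k_j=2$, where $u_1^{(j)}$ is defined).
   Context: $\lambda\widehat\to\infty$ means that $\lambda\to\infty$ inside a sector $\varepsilon<\arg\lambda<\pi-\varepsilon$, $\varepsilon>0$. $\mathbf N$ is the class of Nevanlinna functions (analytic in $\mathbb C_+$, mapping $\mathbb C_+$ into $\mathbb C_+$). $\mathbf N_{-\infty}$ is the set of $F\in\mathbf N$ for which there are real $s_0,s_1,\dots$ with $F(\lambda)=-\frac{s_0}{\lambda}-\dots-\frac{s_{2n}}{\lambda^{2n+1}}+o(\lambda^{-2n-1})$, $\lambda\widehat\to\infty$, for every $n\in\mathbb Z_+$; equivalently $F(\lambda)=\int_{\mathbb R}\frac{d\sigma(t)}{t-\lambda}$ with a finite measure $\sigma$ on $\mathbb R$ having all moments $s_j=\int t^jd\sigma(t)$ finite. $F$ nonrational means $\operatorname{supp}\sigma$ is infinite. Let $P_j$ be the monic orthogonal polynomials of $\sigma/s_0$; they satisfy $\lambda P_j=P_{j+1}+b_jP_j+c_{j-1}P_{j-1}$, $P_{-1}=0$, $P_0=1$, $b_j\in\mathbb R$, $c_j>0$. The monic Jacobi matrix $J$ associated with $F$ is the semi-infinite tridiagonal matrix with $J_{j,j}=b_j$, $J_{j,j+1}=1$, $J_{j+1,j}=c_j$, $j\in\mathbb Z_+$. The normal indices of a real sequence $\{\mathfrak s_j\}_{j\ge0}$ are the integers $n\ge1$ with $\det(\mathfrak s_{i+k})_{i,k=0}^{n-1}\ne0$, listed increasingly as $\mathfrak n_1<\mathfrak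 n_2<\dots$. In the present situation one always has $\mathfrak k_j\in\{1,2\}$. Uniqueness is understood among factorizations of the displayed form (with the given block sizes $\mathfrak k_j$). *)

theory Defs
  imports
    "HOL-Complex_Analysis.Complex_Analysis"
    "HOL-Library.Landau_Symbols"
    "HOL-Library.Infinite_Set"
    "HOL-Library.Groups_Big_Fun"
    "HOL-Computational_Algebra.Polynomial"
    "Jordan_Normal_Form.Determinant"
begin

section \<open>Nevanlinna functions\<close>

definition upper_half_plane :: "complex set" where
  "upper_half_plane = {z. Im z > 0}"

definition nevanlinna :: "(complex \<Rightarrow> complex) set" where
  "nevanlinna = {F. F analytic_on upper_half_plane \<and> F ` upper_half_plane \<subseteq> upper_half_plane}"

definition at_infinity_sector :: "real \<Rightarrow> complex filter" where
  "at_infinity_sector \<epsilon> = inf at_infinity (principal {z. \<epsilon> < Arg z \<and> Arg z < pi - \<epsilon>})"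

definition asymptotic_coeffs :: "(complex \<Rightarrow> complex) \<Rightarrow> (nat \<Rightarrow> real) \<Rightarrow> bool" where
  "asymptotic_coeffs F s \<longleftrightarrow>
     (\<forall>n. \<forall>\<epsilon>>0.
        (\<lambda>z. F z - (- (\<Sum>j\<le>2*n. of_real (s j) / z ^ (j+1))))
          \<in> o[at_infinity_sector \<epsilon>](\<lambda>z. 1 / z ^ (2*n+1)))"

definition nevanlinna_minus_infinity :: "(complex \<Rightarrow> complex) set" where
  "nevanlinna_minus_infinity = {F \<in> nevanlinna. \<exists>s. asymptotic_coeffs F s}"

text \<open>\<open>\<sigma>\<close> is a finite Borel measure on the real line with all moments finite and
  \<open>F(z) = \<integral> d\<sigma>(t)/(t - z)\<close> in the upper half-plane. By the Hamburger--Nevanlinna theorem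
  such a \<open>\<sigma>\<close> exists, and is unique, for every \<open>F\<close> in \<open>nevanlinna_minus_infinity\<close>.\<close>

definition stieltjes_measure_of :: "(complex \<Rightarrow> complex) \<Rightarrow> real measure \<Rightarrow> bool" where
  "stieltjes_measure_of F \<sigma> \<longleftrightarrow>
     finite_measure \<sigma> \<and> sets \<sigma> = sets borel \<and>
     (\<forall>j. integrable \<sigma> (\<lambda>t. t ^ j)) \<and>
     (\<forall>z\<in>upper_half_plane. F z = (\<integral>t. 1 / (of_real t - z) \<partial>\<sigma>))"

definition measure_support :: "'a::topological_space measure \<Rightarrow> 'a set" where
  "measure_support \<mu> = {x. \<forall>V. open V \<and> x \<in> V \<longrightarrow> emeasure \<mu> V \<noteq> 0}"

section \<open>Orthogonal polynomials and the monic Jacobi matrix\<close>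

definition monic_orthogonal_polys :: "real measure \<Rightarrow> (nat \<Rightarrow> real poly) \<Rightarrow> bool" where
  "monic_orthogonal_polys \<mu> P \<longleftrightarrow>
     (\<forall>j. degree (P j) = j \<and> lead_coeff (P j) = 1) \<and>
     (\<forall>i j. i \<noteq> j \<longrightarrow> (\<integral>t. poly (P i) t * poly (P j) t \<partial>\<mu>) = 0)"

text \<open>The summand for \<open>j = 0\<close> vanishes because \<open>P\<^sub>-\<^sub>1 = 0\<close>.\<close>

definition three_term_recurrence ::
    "(nat \<Rightarrow> real poly) \<Rightarrow> (nat \<Rightarrow> real) \<Rightarrow> (nat \<Rightarrow> real) \<Rightarrow> bool" where
  "three_term_recurrence P b c \<longleftrightarrow>
     (\<forall>j. [:0, 1:] * P j =
        P (j+1) + Polynomial.smult (b j) (P j)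
          + (if j = 0 then 0 else Polynomial.smult (c (j-1)) (P (j-1))))"

type_synonym inf_mat = "nat \<Rightarrow> nat \<Rightarrow> real"

definition monic_jacobi_matrix :: "(nat \<Rightarrow> real) \<Rightarrow> (nat \<Rightarrow> real) \<Rightarrow> inf_mat" where
  "monic_jacobi_matrix b c i m =
     (if m = i then b i else if m = i + 1 then 1 else if i = m + 1 then c m else 0)"

text \<open>\<open>Sum_any\<close> sums over the nonzero terms and is \<open>0\<close> if there are infinitely many of them.
  It is only applied to block lower bidiagonal left factors, whose rows are finite.\<close>

definition inf_mat_mult :: "inf_mat \<Rightarrow> inf_mat \<Rightarrow> inf_mat" where
  "inf_mat_mult A B i m = Sum_any (\<lambda>r. A i r * B r m)"

section \<open>Normal indices\<close>

definition hankel_det :: "(nat \<Rightarrow> real) \<Rightarrow> nat \<Rightarrow> real" where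
  "hankel_det s n = Determinant.det (Matrix.mat n n (\<lambda>(i, m). s (i + m)))"

definition normal_indices :: "(nat \<Rightarrow> real) \<Rightarrow> nat set" where
  "normal_indices s = {n. n \<ge> 1 \<and> hankel_det s n \<noteq> 0}"

text \<open>\<open>enumerate\<close> lists the elements of a set increasingly, starting from position \<open>0\<close>;
  the normal indices are numbered from \<open>1\<close>, and \<open>0\<close> is prepended.\<close>

definition normal_index :: "(nat \<Rightarrow> real) \<Rightarrow> nat \<Rightarrow> nat" where
  "normal_index s j = (case j of 0 \<Rightarrow> 0 | Suc i \<Rightarrow> enumerate (normal_indices s) i)"

definition block_size :: "(nat \<Rightarrow> nat) \<Rightarrow> nat \<Rightarrow> nat" where
  "block_size n j = n (j+1) - n j"

section \<open>Block matrices\<close>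

text \<open>For a strictly increasing \<open>n\<close> with \<open>n 0 = 0\<close>, the index \<open>i\<close> belongs to the block \<open>j\<close>
  with \<open>n j \<le> i < n (j+1)\<close>.\<close>

definition block_of :: "(nat \<Rightarrow> nat) \<Rightarrow> nat \<Rightarrow> nat" where
  "block_of n i = (LEAST j. i < n (j+1))"

definition block_matrix :: "(nat \<Rightarrow> nat) \<Rightarrow> (nat \<Rightarrow> nat \<Rightarrow> real Matrix.mat) \<Rightarrow> inf_mat" where
  "block_matrix n B i m =
     B (block_of n i) (block_of n m) $$ (i - n (block_of n i), m - n (block_of n m))"

definition block_L :: "(nat \<Rightarrow> nat) \<Rightarrow> (nat \<Rightarrow> real) \<Rightarrow> nat \<Rightarrow> real Matrix.mat" where
  "block_L k l j =
     Matrix.mat (k j) (k (j-1)) (\<lambda>(i, m). if i = 0 \<and> m = 0 then l j else 0)"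

text \<open>Only the block sizes \<open>1\<close> and \<open>2\<close> occur.\<close>

definition block_U ::
    "(nat \<Rightarrow> nat) \<Rightarrow> (nat \<Rightarrow> real) \<Rightarrow> (nat \<Rightarrow> real) \<Rightarrow> nat \<Rightarrow> real Matrix.mat" where
  "block_U k u0 u1 j =
     (if k j = 1 then mat_of_rows_list 1 [[u0 j]]
      else mat_of_rows_list 2 [[0, 1], [u0 j, u1 j]])"

definition block_D :: "(nat \<Rightarrow> nat) \<Rightarrow> nat \<Rightarrow> real Matrix.mat" where
  "block_D k j =
     Matrix.mat (k j) (k (j+1)) (\<lambda>(i, m). if i = k j - 1 \<and> m = 0 then 1 else 0)"

text \<open>The numbers \<open>l\<^sub>1, l\<^sub>2, \<dots>\<close> are \<open>l 1, l 2, \<dots>\<close>; the value \<open>l 0\<close> is not used, and neither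
  is \<open>u1 j\<close> when the \<open>j\<close>-th block has size \<open>1\<close>.\<close>

definition lower_factor :: "(nat \<Rightarrow> nat) \<Rightarrow> (nat \<Rightarrow> real) \<Rightarrow> inf_mat" where
  "lower_factor n l = block_matrix n (\<lambda>p q.
     if p = q then 1\<^sub>m (block_size n p)
     else if p = q + 1 then block_L (block_size n) l p
     else 0\<^sub>m (block_size n p) (block_size n q))"

definition upper_factor ::
    "(nat \<Rightarrow> nat) \<Rightarrow> (nat \<Rightarrow> real) \<Rightarrow> (nat \<Rightarrow> real) \<Rightarrow> inf_mat" where
  "upper_factor n u0 u1 = block_matrix n (\<lambda>p q.
     if p = q then block_U (block_size n) u0 u1 p
     else if q = p + 1 then block_D (block_size n) p
     else 0\<^sub>m (block_size n p) (block_size n q))"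

end

theory Submission
  imports Defs
begin

text \<open>The asymptotic coefficients of \<open>F\<close> are the moments of \<open>\<sigma>\<close>, and as the support of \<open>\<sigma>\<close> is
  infinite, \<open>\<integral> p\<^sup>2 d\<sigma> > 0\<close> for every nonzero polynomial \<open>p\<close>. A vector in the kernel of the Hankel matrix
  \<open>(s\<^sub>i\<^sub>+\<^sub>k\<^sub>+\<^sub>1)\<close> of order \<open>n\<close> is a polynomial \<open>q\<close> of degree below \<open>n\<close> for which \<open>t q\<close> is orthogonal to all
  polynomials of degree below \<open>n\<close>, that is, a multiple of \<open>P\<^sub>n\<close>. Hence \<open>n \<ge> 1\<close> is a normal index of the
  shifted sequence if and only if \<open>P\<^sub>n(0) \<noteq> 0\<close> (\<open>hankel_det_shifted_eq_0_iff\<close>).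

  Put \<open>a\<^sub>i = P\<^sub>i(0)\<close>. The three-term recurrence gives \<open>a\<^sub>i\<^sub>+\<^sub>2 = - b\<^sub>i\<^sub>+\<^sub>1 a\<^sub>i\<^sub>+\<^sub>1 - c\<^sub>i a\<^sub>i\<close> with \<open>c\<^sub>i > 0\<close> and \<open>a\<^sub>0 = 1\<close>, so two
  consecutive \<open>a\<^sub>i\<close> never vanish together. The blocks therefore have size \<open>1\<close> or \<open>2\<close>, each begins at an
  index with \<open>a\<^sub>i \<noteq> 0\<close>, and the second index of a block of size \<open>2\<close> has \<open>a\<^sub>i = 0\<close>.

  With such blocks, the product \<open>L U\<close> is tridiagonal with superdiagonal \<open>1\<close>, and \<open>J = L U\<close> amounts to
  scalar equations between neighbouring blocks (\<open>jacobi_eq_mult_iff\<close>). They determine the coefficients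
  one after the other: the upper-left entry of the \<open>j\<close>-th diagonal block of \<open>U\<close> must be
  \<open>- a (n j + 1) / a (n j)\<close>, since both satisfy the same recursion, and everything else follows from \<open>J\<close> and
  these entries (\<open>jacobi_eq_mult_iff_coeffs\<close>). Conversely the values found solve the equations by
  the recurrence of \<open>a\<close>.\<close>

section \<open>Asymptotic coefficients and moments\<close>

text \<open>On the imaginary axis \<open>\<bar>t - \<i> y\<bar> \<ge> y\<close>, so the geometric expansion of \<open>1 / (t - \<i> y)\<close> up to order
  \<open>m\<close> integrates termwise with an error controlled by the absolute moment of order \<open>m\<close>.\<close>

lemma cauchy_transform_expansion:
  fixes M :: "real measure"
  assumes "finite_measure M" and sets: "sets M = sets borel" and mom: "\<And>j. integrable M (\<lambda>t::real. t ^ j)" and y: "y > 0"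
  shows "norm ((\<integral>t. 1 / (of_real t - \<i> * of_real y) \<partial>M) +
      (\<Sum>j<m. of_real (\<integral>t. t ^ j \<partial>M) / (\<i> * of_real y) ^ (j+1)))
    \<le> (\<integral>t. \<bar>t\<bar> ^ m \<partial>M) / y ^ (m+1)"
proof -
  interpret finite_measure M by fact
  define z where "z = \<i> * complex_of_real y"
  have z: "z \<noteq> 0" and nz: "cmod z = y" using y by (auto simp: z_def norm_mult)
  have tz: "complex_of_real t - z \<noteq> 0" and ntz: "cmod (complex_of_real t - z) \<ge> y" for t
  proof -
    have "\<bar>Im (complex_of_real t - z)\<bar> \<le> cmod (complex_of_real t - z)" by (rule abs_Im_le_cmod)
    then show "cmod (complex_of_real t - z) \<ge> y" using y by (simp add: z_def)
    then show "complex_of_real t - z \<noteq> 0" using y by auto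
  qed
  have expand: "1 / (of_real t - z) + (\<Sum>j<m. of_real (t ^ j) / z ^ (j+1)) = of_real t ^ m / (z ^ m * (of_real t - z))" for t
  proof (induction m)
    case (Suc m)
    have "1 / (of_real t - z) + (\<Sum>j<Suc m. of_real (t ^ j) / z ^ (j+1)) =
        of_real t ^ m / (z ^ m * (of_real t - z)) + of_real t ^ m / z ^ (m+1)"
      using Suc by (simp add: add.assoc [symmetric])
    also have "\<dots> = of_real t ^ Suc m / (z ^ Suc m * (of_real t - z))"
      using z tz[of t] by (simp add: divide_simps) (simp add: algebra_simps)
    finally show ?case .
  qed simp
  have meas[measurable]: "f \<in> borel_measurable M" if "f \<in> borel_measurable borel" for f :: "real \<Rightarrow> complex"
    using that sets by (simp cong: measurable_cong_sets)
  have cont: "continuous_on UNIV (\<lambda>t. 1 / (complex_of_real t - z))"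
    by (intro continuous_intros) (use tz in auto)
  have int1: "integrable M (\<lambda>t. 1 / (complex_of_real t - z))"
  proof (rule integrable_const_bound[where B = "1 / y"])
    show "AE t in M. norm (1 / (complex_of_real t - z)) \<le> 1 / y"
    proof (rule AE_I2)
      fix t show "norm (1 / (complex_of_real t - z)) \<le> 1 / y"
        using frac_le[OF _ _ y ntz[of t], of 1 1] by (simp add: norm_divide)
    qed
  qed (intro meas borel_measurable_continuous_onI cont)
  have int2: "integrable M (\<lambda>t. complex_of_real (t ^ j) / z ^ (j+1))" for j
    using mom[of j] by (intro integrable_divide_zero integrable_of_real) auto
  have "(\<integral>t. 1 / (of_real t - z) \<partial>M) + (\<Sum>j<m. of_real (\<integral>t. t ^ j \<partial>M) / z ^ (j+1)) =
      (\<integral>t. 1 / (of_real t - z) + (\<Sum>j<m. of_real (t ^ j) / z ^ (j+1)) \<partial>M)"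
  proof -
    have "of_real (\<integral>t. t ^ j \<partial>M) / z ^ (j+1) = (\<integral>t. of_real (t ^ j) / z ^ (j+1) \<partial>M)" for j
      by (simp only: integral_divide_zero integral_complex_of_real)
    then have "(\<Sum>j<m. of_real (\<integral>t. t ^ j \<partial>M) / z ^ (j+1)) =
        (\<integral>t. (\<Sum>j<m. of_real (t ^ j) / z ^ (j+1)) \<partial>M)"
      using int2 by (simp only: Bochner_Integration.integral_sum)
    then show ?thesis
      using int1 int2 by (simp only: Bochner_Integration.integral_add Bochner_Integration.integrable_sum)
  qed
  also have "norm \<dots> \<le> (\<integral>t. \<bar>t\<bar> ^ m / y ^ (m+1) \<partial>M)"
  proof (rule Bochner_Integration.integral_norm_bound_integral)
    show "integrable M (\<lambda>t. 1 / (complex_of_real t - z) + (\<Sum>j<m. of_real (t ^ j) / z ^ (j+1)))"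
      using int1 int2 by (intro Bochner_Integration.integrable_add Bochner_Integration.integrable_sum)
    show "integrable M (\<lambda>t. \<bar>t\<bar> ^ m / y ^ (m+1))"
      using integrable_abs[OF mom[of m]] by (simp add: power_abs)
    fix t
    have "norm (of_real t ^ m / (z ^ m * (of_real t - z))) = \<bar>t\<bar> ^ m / (y ^ m * cmod (of_real t - z))"
      by (simp add: norm_divide norm_mult norm_power nz)
    also have "\<dots> \<le> \<bar>t\<bar> ^ m / y ^ (m+1)"
      using ntz[of t] y by (intro frac_le) (auto simp: mult.commute)
    finally show "norm (1 / (complex_of_real t - z) + (\<Sum>j<m. of_real (t ^ j) / z ^ (j+1))) \<le> \<bar>t\<bar> ^ m / y ^ (m+1)"
      unfolding expand .
  qed
  finally show ?thesis by (simp add: z_def)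
qed

text \<open>The sector with \<open>\<epsilon> = 1\<close> contains the positive imaginary axis because \<open>1 < \<pi> / 2 < \<pi> - 1\<close>.\<close>

lemma filterlim_imaginary_axis: "filterlim (\<lambda>y. \<i> * complex_of_real y) (at_infinity_sector 1) at_top"
  unfolding at_infinity_sector_def filterlim_inf filterlim_principal
proof
  show "filterlim (\<lambda>y. \<i> * complex_of_real y) at_infinity at_top"
    by (rule filterlim_norm_at_top_imp_at_infinity) (simp add: norm_mult filterlim_abs_real)
  show "\<forall>\<^sub>F y in at_top. \<i> * complex_of_real y \<in> {z. 1 < Arg z \<and> Arg z < pi - 1}"
    using eventually_gt_at_top[of 0]
  proof eventually_elim
    case (elim y)
    have "Arg (\<i> * complex_of_real y) = pi / 2"
      using Arg_times_of_real2[OF elim, of \<i>] by simp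
    then show ?case using pi_gt3 by simp
  qed
qed

text \<open>Both \<open>s\<close> and the moments are coefficients of an asymptotic expansion of \<open>F\<close> along the
  imaginary axis, and such coefficients are unique.\<close>

lemma asymptotic_coeffs_eq_moments:
  assumes F: "stieltjes_measure_of F \<sigma>" and s: "asymptotic_coeffs F s"
  shows "s m = (\<integral>t. t ^ m \<partial>\<sigma>)"
proof -
  define \<mu> where "\<mu> j = (\<integral>t. t ^ j \<partial>\<sigma>)" for j
  define z where "z y = \<i> * complex_of_real y" for y
  define d where "d j = complex_of_real (s j - \<mu> j)" for j
  define g where "g N = (\<lambda>y. \<Sum>j\<le>2*N. d j / z y ^ (j+1))" for N
  have small: "((\<lambda>y. g N y * z y ^ (2*N+1)) \<longlongrightarrow> 0) at_top" for N
  proof -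
    have "(\<lambda>w. F w - (- (\<Sum>j\<le>2*N. of_real (s j) / w ^ (j+1))))
        \<in> o[at_infinity_sector 1](\<lambda>w. 1 / w ^ (2*N+1))"
      using s unfolding asymptotic_coeffs_def by simp
    from landau_o.small.compose[OF this filterlim_imaginary_axis]
    have "(\<lambda>y. F (z y) + (\<Sum>j\<le>2*N. of_real (s j) / z y ^ (j+1))) \<in> o(\<lambda>y. 1 / z y ^ (2*N+1))"
      by (simp add: z_def)
    from smalloD_tendsto[OF this]
    have lim1: "((\<lambda>y. (F (z y) + (\<Sum>j\<le>2*N. of_real (s j) / z y ^ (j+1))) * z y ^ (2*N+1)) \<longlongrightarrow> 0) at_top"
      by (simp add: divide_simps)
    let ?M = "\<integral>t. \<bar>t\<bar> ^ (2*N+1) \<partial>\<sigma>"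
    have lim2: "((\<lambda>y. (F (z y) + (\<Sum>j\<le>2*N. of_real (\<mu> j) / z y ^ (j+1))) * z y ^ (2*N+1)) \<longlongrightarrow> 0) at_top"
    proof (rule Lim_null_comparison)
      show "((\<lambda>y. ?M / y) \<longlongrightarrow> 0) at_top"
        by (intro tendsto_divide_0[OF tendsto_const] filterlim_at_top_imp_at_infinity filterlim_ident)
      show "\<forall>\<^sub>F y in at_top. norm ((F (z y) + (\<Sum>j\<le>2*N. of_real (\<mu> j) / z y ^ (j+1))) * z y ^ (2*N+1)) \<le> ?M / y"
        using eventually_gt_at_top[of 0]
      proof eventually_elim
        case (elim y)
        have "F (z y) = (\<integral>t. 1 / (of_real t - \<i> * of_real y) \<partial>\<sigma>)"
          using F elim by (simp add: stieltjes_measure_of_def z_def upper_half_plane_def)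
        moreover have "norm ((\<integral>t. 1 / (of_real t - \<i> * of_real y) \<partial>\<sigma>) + (\<Sum>j<2*N+1. of_real (\<mu> j) / z y ^ (j+1))) \<le> ?M / y ^ (2*N+1+1)"
          unfolding \<mu>_def z_def
          by (rule cauchy_transform_expansion) (use F elim in \<open>auto simp: stieltjes_measure_of_def\<close>)
        ultimately have "norm (F (z y) + (\<Sum>j\<le>2*N. of_real (\<mu> j) / z y ^ (j+1))) \<le> ?M / y ^ (2*N+1+1)"
          by (simp add: lessThan_Suc_atMost del: sum.lessThan_Suc)
        moreover have "norm (z y ^ (2*N+1)) = y ^ (2*N+1)"
          using elim by (simp add: norm_mult norm_power z_def)
        ultimately have "norm ((F (z y) + (\<Sum>j\<le>2*N. of_real (\<mu> j) / z y ^ (j+1))) * z y ^ (2*N+1)) \<le>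
            ?M / y ^ (2*N+1+1) * y ^ (2*N+1)"
          using elim by (subst norm_mult) (intro mult_mono, auto)
        also have "\<dots> = ?M / y" using elim by simp
        finally show ?case .
      qed
    qed
    have "((\<lambda>y. (F (z y) + (\<Sum>j\<le>2*N. of_real (s j) / z y ^ (j+1))) * z y ^ (2*N+1) -
        (F (z y) + (\<Sum>j\<le>2*N. of_real (\<mu> j) / z y ^ (j+1))) * z y ^ (2*N+1)) \<longlongrightarrow> 0 - 0) at_top"
      by (intro tendsto_diff lim1 lim2)
    then show ?thesis
      by (simp add: g_def d_def left_diff_distrib [symmetric] sum_subtractf [symmetric] diff_divide_distrib)
  qed
  have z_inf: "filterlim z at_infinity at_top"
    using filterlim_imaginary_axis unfolding z_def at_infinity_sector_def by (auto simp: filterlim_inf)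
  have d_0: "d m = 0" for m
  proof (induction m rule: less_induct)
    case (less m)
    have inv: "((\<lambda>y. 1 / z y ^ k) \<longlongrightarrow> 0) at_top" if "k > 0" for k
      by (rule tendsto_divide_0[OF tendsto_const Limits.filterlim_power_at_infinity[OF z_inf that]])
    \<comment> \<open>The lower differences vanish, so multiplying by \<open>z ^ (m + 1)\<close> isolates \<open>d m\<close> in the limit.\<close>
    have "((\<lambda>y. g m y * z y ^ (2*m+1) * (1 / z y ^ m)) \<longlongrightarrow> 0) at_top"
    proof (cases "m = 0")
      case False
      then show ?thesis using tendsto_mult[OF small inv[of m]] by simp
    qed (use small[of 0] in simp)
    moreover have "\<forall>\<^sub>F y in at_top. g m y * z y ^ (2*m+1) * (1 / z y ^ m) = d m + (\<Sum>j\<in>{m<..2*m}. d j * (1 / z y ^ (j - m)))"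
      using eventually_gt_at_top[of 0]
    proof eventually_elim
      case (elim y)
      then have z: "z y \<noteq> 0" by (simp add: z_def)
      have "g m y = (\<Sum>j\<in>{m..2*m}. d j / z y ^ (j+1))"
        unfolding g_def by (rule sum.mono_neutral_right) (use less in auto)
      then have "g m y * z y ^ (2*m+1) * (1 / z y ^ m) = (\<Sum>j\<in>{m..2*m}. d j / z y ^ (j+1)) * z y ^ (m+1)"
        using z by (simp add: mult_2 power_add)
      also have "\<dots> = (\<Sum>j\<in>{m..2*m}. d j * (1 / z y ^ (j - m)))"
        unfolding sum_distrib_right
      proof (rule sum.cong)
        fix j assume "j \<in> {m..2*m}"
        then have "z y ^ (j+1) = z y ^ (m+1) * z y ^ (j - m)"
          by (simp flip: power_add)
        then show "d j / z y ^ (j+1) * z y ^ (m+1) = d j * (1 / z y ^ (j - m))"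
          using z by simp
      qed simp
      also have "\<dots> = d m + (\<Sum>j\<in>{m<..2*m}. d j * (1 / z y ^ (j - m)))"
        by (subst sum.head) auto
      finally show ?case .
    qed
    ultimately have "((\<lambda>y. d m + (\<Sum>j\<in>{m<..2*m}. d j * (1 / z y ^ (j - m)))) \<longlongrightarrow> 0) at_top"
      by (rule Lim_transform_eventually)
    moreover have "((\<lambda>y. d m + (\<Sum>j\<in>{m<..2*m}. d j * (1 / z y ^ (j - m)))) \<longlongrightarrow> d m + (\<Sum>j\<in>{m<..2*m}. d j * 0)) at_top"
      by (intro tendsto_intros inv) auto
    ultimately show ?case
      using tendsto_unique[OF trivial_limit_at_top_linorder] by fastforce
  qed
  from d_0[of m] show ?thesis by (simp add: d_def \<mu>_def flip: of_real_diff)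
qed

section \<open>Orthogonal polynomials and shifted Hankel determinants\<close>

lemma scale_measure_eq_density:
  "0 \<le> r \<Longrightarrow> scale_measure (ennreal r) M = density M (\<lambda>_. ennreal r)"
  by (rule measure_eqI) (simp_all add: emeasure_density_const)

lemma integral_scale_measure:
  fixes f :: "'a \<Rightarrow> real"
  assumes "0 \<le> r" "f \<in> borel_measurable M"
  shows "(\<integral>x. f x \<partial>scale_measure (ennreal r) M) = r * (\<integral>x. f x \<partial>M)"
  using assms by (simp add: scale_measure_eq_density integral_real_density)

text \<open>A Borel measure on the real line with finite moments, among them its total mass, and with
  infinite support.\<close>

locale moment_measure =
  fixes \<sigma> :: "real measure"
  assumes sets_borel: "sets \<sigma> = sets borel"
    and integrable_power: "\<And>j. integrable \<sigma> (\<lambda>t. t ^ j)"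
    and infinite_support: "infinite (measure_support \<sigma>)"
begin

text \<open>The moment functional \<open>p \<mapsto> \<integral> p d\<sigma>\<close>, which is not normalized by the total mass.\<close>

definition mean :: "real poly \<Rightarrow> real" where
  "mean p = (\<integral>t. poly p t \<partial>\<sigma>)"

lemma borel_measurable_poly: "poly p \<in> borel_measurable \<sigma>"
proof -
  have "poly p \<in> borel_measurable borel"
    by (intro borel_measurable_continuous_onI continuous_intros)
  then show ?thesis
    using sets_borel by (simp cong: measurable_cong_sets)
qed

lemma integrable_poly: "integrable \<sigma> (poly p)"
proof -
  have "integrable \<sigma> (\<lambda>t. \<Sum>i\<le>degree p. coeff p i * t ^ i)"
    by (intro Bochner_Integration.integrable_sum integrable_mult_right integrable_power)
  then show ?thesis by (simp add: poly_altdef [abs_def])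
qed

lemma mean_0 [simp]: "mean 0 = 0"
  by (simp add: mean_def)

lemma mean_add: "mean (p + q) = mean p + mean q"
  by (simp add: mean_def integrable_poly)

lemma mean_diff: "mean (p - q) = mean p - mean q"
  by (simp add: mean_def integrable_poly)

lemma mean_smult: "mean (Polynomial.smult c p) = c * mean p"
  by (simp add: mean_def)

lemma mean_sum: "mean (\<Sum>i\<in>A. f i) = (\<Sum>i\<in>A. mean (f i))"
  by (induction A rule: infinite_finite_induct) (simp_all add: mean_add)

text \<open>If \<open>\<integral> p\<^sup>2 d\<sigma> = 0\<close>, then \<open>\<sigma>\<close> lives on the finite set of roots of \<open>p\<close>.\<close>

lemma mean_square_pos:
  assumes "p \<noteq> 0"
  shows "mean (p * p) > 0"
proof -
  have "mean (p * p) \<ge> 0"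
    unfolding mean_def by (rule Bochner_Integration.integral_nonneg) simp
  moreover have "mean (p * p) \<noteq> 0"
  proof
    assume "mean (p * p) = 0"
    then have "AE t in \<sigma>. poly (p * p) t = 0"
      unfolding mean_def
      by (subst (asm) integral_nonneg_eq_0_iff_AE[OF integrable_poly]) auto
    then have AE: "AE t in \<sigma>. poly p t = 0" by simp
    define V where "V = {t. poly p t \<noteq> 0}"
    have fin: "finite (- V)"
      using poly_roots_finite[OF assms] by (simp add: V_def Collect_neg_eq [symmetric])
    have "open V"
      using finite_imp_closed[OF fin] by (simp add: closed_def)
    have "emeasure \<sigma> V = 0"
    proof -
      have "V \<in> sets \<sigma>" using \<open>open V\<close> sets_borel by simp
      then have "V \<in> null_sets \<sigma>"
        using AE by (subst AE_iff_null_sets) (auto simp: V_def)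
      then show ?thesis by auto
    qed
    with \<open>open V\<close> have "measure_support \<sigma> \<subseteq> - V"
      by (auto simp: measure_support_def)
    with fin infinite_support show False
      using finite_subset by blast
  qed
  ultimately show ?thesis by simp
qed

lemma mean_mult_0_if_monomials:
  assumes "\<And>i. i < n \<Longrightarrow> mean (monom 1 i * p) = 0" and "degree q < n"
  shows "mean (p * q) = 0"
proof -
  have "q = (\<Sum>i\<le>degree q. Polynomial.smult (coeff q i) (monom 1 i))"
    by (simp add: smult_monom poly_as_sum_of_monoms)
  then have "mean (p * q) = mean (p * (\<Sum>i\<le>degree q. Polynomial.smult (coeff q i) (monom 1 i)))"
    by simp
  also have "\<dots> = (\<Sum>i\<le>degree q. coeff q i * mean (monom 1 i * p))"
    by (simp add: sum_distrib_left mean_sum mean_smult mult.commute)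
  also have "\<dots> = 0"
    using assms by (intro sum.neutral) auto
  finally show ?thesis .
qed

end

text \<open>The monic orthogonal polynomials of a measure as above; orthogonality is insensitive to
  a rescaling of the measure.\<close>

locale monic_orthogonal = moment_measure +
  fixes P :: "nat \<Rightarrow> real poly"
  assumes degree_P: "degree (P j) = j"
    and monic_P: "lead_coeff (P j) = 1"
    and orthogonal: "i \<noteq> j \<Longrightarrow> mean (P i * P j) = 0"
begin

lemma coeff_P: "coeff (P j) j = 1"
  using monic_P[of j] degree_P[of j] by simp

lemma P_nonzero: "P j \<noteq> 0"
  using coeff_P[of j] by auto

lemma reduce_degree:
  assumes "degree q \<le> m"
  shows "q - Polynomial.smult (coeff q m) (P m) = 0 \<or> degree (q - Polynomial.smult (coeff q m) (P m)) < m"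
proof (rule eq_zero_or_degree_less)
  show "degree (q - Polynomial.smult (coeff q m) (P m)) \<le> m"
    using assms degree_P[of m] by (intro degree_diff_le) (auto intro: order_trans[OF degree_smult_le])
  show "coeff (q - Polynomial.smult (coeff q m) (P m)) m = 0"
    by (simp add: coeff_P)
qed

lemma orthogonal_lower: "degree q < n \<Longrightarrow> mean (P n * q) = 0"
proof (induction "degree q" arbitrary: q rule: less_induct)
  case less
  let ?m = "degree q"
  let ?r = "q - Polynomial.smult (coeff q ?m) (P ?m)"
  have "mean (P n * ?r) = 0"
    using reduce_degree[of q ?m] less by auto
  moreover have "mean (P n * P ?m) = 0"
    using less.prems by (intro orthogonal) simp
  ultimately show ?case
    by (simp add: right_diff_distrib mean_diff mean_smult)
qed

lemma mean_mult_degree_le: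
  assumes "degree q \<le> n"
  shows "mean (P n * q) = coeff q n * mean (P n * P n)"
proof -
  have "mean (P n * (q - Polynomial.smult (coeff q n) (P n))) = 0"
    using reduce_degree[OF assms] orthogonal_lower by auto
  then show ?thesis
    by (simp add: right_diff_distrib mean_diff mean_smult)
qed

lemma eq_smult_P_if_orthogonal:
  assumes "degree p \<le> n" and orth: "\<And>q. degree q < n \<Longrightarrow> mean (p * q) = 0"
  shows "p = Polynomial.smult (coeff p n) (P n)"
proof (rule ccontr)
  let ?r = "p - Polynomial.smult (coeff p n) (P n)"
  assume "p \<noteq> Polynomial.smult (coeff p n) (P n)"
  then have "?r \<noteq> 0" by simp
  with reduce_degree[OF assms(1)] have "degree ?r < n" by blast
  then have "mean (p * ?r) = 0" "mean (P n * ?r) = 0"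
    using orth orthogonal_lower by blast+
  then have "mean (?r * ?r) = 0"
    using mean_diff[of "p * ?r" "Polynomial.smult (coeff p n) (P n * ?r)"]
    by (simp add: mean_smult left_diff_distrib)
  with mean_square_pos[OF \<open>?r \<noteq> 0\<close>] show False by simp
qed

text \<open>Identify a vector with the polynomial \<open>q\<close> having these coefficients. The Hankel matrix of
  the shifted moments then sends \<open>q\<close> to the moments \<open>\<integral> t\<^sup>i (t q) d\<sigma>\<close>.\<close>

lemma hankel_mult_vec:
  assumes "degree q < n" "i < n"
  shows "(Matrix.mat n n (\<lambda>(i, m). \<integral>t. t ^ (i + m + 1) \<partial>\<sigma>) *\<^sub>v Matrix.vec n (coeff q)) $ i =
    mean (monom 1 i * pCons 0 q)"
proof -
  have q: "q = (\<Sum>k<n. Polynomial.smult (coeff q k) (monom 1 k))"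
    using assms(1) by (intro poly_eqI) (simp add: smult_monom coeff_sum coeff_eq_0)
  have mono: "mean (monom 1 j) = (\<integral>t. t ^ j \<partial>\<sigma>)" for j
    by (simp add: mean_def poly_monom)
  have "pCons 0 q = monom 1 1 * q"
    by (simp add: monom_altdef)
  then have "monom 1 i * pCons 0 q = monom 1 (i + 1) * q"
    by (simp add: mult_monom flip: mult.assoc)
  also have "\<dots> = monom 1 (i + 1) * (\<Sum>k<n. Polynomial.smult (coeff q k) (monom 1 k))"
    using q by simp
  also have "\<dots> = (\<Sum>k<n. Polynomial.smult (coeff q k) (monom 1 (i + k + 1)))"
    by (simp add: sum_distrib_left mult_monom)
  finally have "mean (monom 1 i * pCons 0 q) = (\<Sum>k<n. coeff q k * (\<integral>t. t ^ (i + k + 1) \<partial>\<sigma>))"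
    by (simp add: mean_sum mean_smult mono del: power_Suc)
  then show ?thesis
    using assms(2) by (simp add: scalar_prod_def atLeast0LessThan mult.commute del: power_Suc)
qed

text \<open>A kernel vector \<open>q\<close> of the shifted Hankel matrix makes \<open>t q\<close>, of degree at most \<open>n\<close>, orthogonal
  to all polynomials of degree below \<open>n\<close>; hence \<open>t q\<close> is a multiple of \<open>P n\<close>. So a nonzero
  kernel vector exists exactly when \<open>t\<close> divides \<open>P n\<close>.\<close>

lemma hankel_det_shifted_eq_0_iff:
  "hankel_det (\<lambda>j. \<integral>t. t ^ (j + 1) \<partial>\<sigma>) n = 0 \<longleftrightarrow> poly (P n) 0 = 0"
proof -
  let ?A = "Matrix.mat n n (\<lambda>(i, m). \<integral>t. t ^ (i + m + 1) \<partial>\<sigma>)"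
  have "hankel_det (\<lambda>j. \<integral>t. t ^ (j + 1) \<partial>\<sigma>) n = 0 \<longleftrightarrow>
      (\<exists>v. v \<in> carrier_vec n \<and> v \<noteq> 0\<^sub>v n \<and> ?A *\<^sub>v v = 0\<^sub>v n)"
    unfolding hankel_det_def by (rule det_0_iff_vec_prod_zero_field) simp
  also have "\<dots> \<longleftrightarrow> poly (P n) 0 = 0"
  proof
    assume "\<exists>v. v \<in> carrier_vec n \<and> v \<noteq> 0\<^sub>v n \<and> ?A *\<^sub>v v = 0\<^sub>v n"
    then obtain v where v: "v \<in> carrier_vec n" "v \<noteq> 0\<^sub>v n" "?A *\<^sub>v v = 0\<^sub>v n" by blast
    define q where "q = (\<Sum>k<n. monom (v $ k) k)"
    have coeff_q: "coeff q k = (if k < n then v $ k else 0)" for k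
      by (auto simp: q_def coeff_sum)
    have v_eq: "v = Matrix.vec n (coeff q)"
      using v(1) by (intro eq_vecI) (auto simp: coeff_q)
    with v(2) have "q \<noteq> 0" by auto
    then have deg: "degree q < n"
      using coeff_q[of "degree q"] by (metis leading_coeff_0_iff)
    have "mean (monom 1 i * pCons 0 q) = 0" if "i < n" for i
    proof -
      have "(?A *\<^sub>v v) $ i = 0"
        using that by (simp only: v(3) index_zero_vec)
      then show ?thesis
        unfolding v_eq hankel_mult_vec[OF deg that] .
    qed
    then have "\<And>r. degree r < n \<Longrightarrow> mean (pCons 0 q * r) = 0"
      by (rule mean_mult_0_if_monomials)
    moreover have "degree (pCons 0 q) \<le> n"
      using deg by (simp add: degree_pCons_eq_if)
    ultimately have eq: "pCons 0 q = Polynomial.smult (coeff (pCons 0 q) n) (P n)"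
      using eq_smult_P_if_orthogonal by blast
    with \<open>q \<noteq> 0\<close> have "coeff (pCons 0 q) n \<noteq> 0"
      by (metis pCons_eq_0_iff smult_0_left)
    moreover have "coeff (pCons 0 q) n * poly (P n) 0 = 0"
      using arg_cong[OF eq, of "\<lambda>p. poly p 0"] by simp
    ultimately show "poly (P n) 0 = 0" by simp
  next
    assume "poly (P n) 0 = 0"
    then obtain q where q: "P n = pCons 0 q"
      by (cases "P n") auto
    with P_nonzero[of n] have "q \<noteq> 0" by auto
    with q degree_P[of n] have deg: "Suc (degree q) = n" by simp
    let ?v = "Matrix.vec n (coeff q)"
    have "?v $ degree q \<noteq> 0\<^sub>v n $ degree q"
      using deg \<open>q \<noteq> 0\<close> by auto
    then have "?v \<noteq> 0\<^sub>v n" by metis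
    moreover have "?A *\<^sub>v ?v = 0\<^sub>v n"
    proof (rule eq_vecI)
      fix i assume "i < dim_vec (0\<^sub>v n :: real Matrix.vec)"
      then have i: "i < n" by simp
      have "mean (P n * monom 1 i) = 0"
        using i by (intro orthogonal_lower) (simp add: degree_monom_eq)
      then show "(?A *\<^sub>v ?v) $ i = 0\<^sub>v n $ i"
        using hankel_mult_vec[OF _ i, of q] deg i by (simp add: q mult.commute)
    qed simp
    ultimately show "\<exists>v. v \<in> carrier_vec n \<and> v \<noteq> 0\<^sub>v n \<and> ?A *\<^sub>v v = 0\<^sub>v n"
      by (intro exI[of _ ?v]) auto
  qed
  finally show ?thesis .
qed

lemma recurrence_coeff_pos:
  assumes "three_term_recurrence P b c"
  shows "c j > 0"
proof -
  have rec: "[:0, 1:] * P (j + 1) = P (j + 2) + Polynomial.smult (b (j + 1)) (P (j + 1)) + Polynomial.smult (c j) (P j)"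
    using assms[unfolded three_term_recurrence_def, rule_format, of "j + 1"] by simp
  let ?x = "[:0, 1:] :: real poly"
  have "mean (P (j + 1) * (?x * P j)) = mean (P j * (?x * P (j + 1)))"
    by (simp only: ac_simps)
  also have "\<dots> = c j * mean (P j * P j)"
    unfolding rec by (simp add: distrib_left mean_add mean_smult orthogonal)
  finally have "c j * mean (P j * P j) = mean (P (j + 1) * (?x * P j))" ..
  also have "\<dots> = coeff (?x * P j) (j + 1) * mean (P (j + 1) * P (j + 1))"
    by (rule mean_mult_degree_le) (simp add: degree_pCons_eq_if degree_P)
  also have "\<dots> = mean (P (j + 1) * P (j + 1))"
    by (simp add: coeff_P)
  finally have "c j * mean (P j * P j) > 0"
    using mean_square_pos[OF P_nonzero] by simp
  then show ?thesis
    using mean_square_pos[OF P_nonzero[of j]] by (simp add: zero_less_mult_iff)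
qed

end

section \<open>Block bidiagonal factors\<close>

lemma monic_jacobi_row_eq_iff:
  "(\<forall>m. monic_jacobi_matrix b c (Suc i) m =
      (if m = i then x else if m = Suc i then y else if m = Suc (Suc i) then 1 else 0)) \<longleftrightarrow>
    c i = x \<and> b (Suc i) = y"
  (is "(\<forall>m. ?P m) \<longleftrightarrow> _")
proof
  assume "\<forall>m. ?P m"
  then have "?P i" "?P (Suc i)" by blast+
  then show "c i = x \<and> b (Suc i) = y" by (simp add: monic_jacobi_matrix_def)
qed (auto simp: monic_jacobi_matrix_def)

text \<open>The numbers \<open>n j\<close> are the first indices of the consecutive blocks, all of size \<open>1\<close> or \<open>2\<close>.\<close>

locale block_partition =
  fixes n :: "nat \<Rightarrow> nat"
  assumes start: "n 0 = 0"
    and step: "\<And>j. n (Suc j) = n j + 1 \<or> n (Suc j) = n j + 2"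
begin

lemma less_Suc: "n j < n (Suc j)"
  using step[of j] by auto

lemma strict_mono_n: "strict_mono n"
  by (simp add: strict_mono_Suc_iff less_Suc)

lemma block_size_cases: "block_size n j = 1 \<or> block_size n j = 2"
  using step[of j] by (auto simp: block_size_def)

lemma Suc_eq_add_block_size: "n (Suc j) = n j + block_size n j"
  using less_Suc[of j] by (simp add: block_size_def)

lemma block_of_add: "r < block_size n j \<Longrightarrow> block_of n (n j + r) = j"
  unfolding block_of_def
proof (rule Least_equality)
  assume r: "r < block_size n j"
  then show "n j + r < n (j + 1)"
    by (simp add: Suc_eq_add_block_size)
  fix i assume i: "n j + r < n (i + 1)"
  show "j \<le> i"
  proof (rule ccontr)
    assume "\<not> j \<le> i"
    then have "n (i + 1) \<le> n j"
      using strict_mono_n by (simp add: strict_mono_less_eq)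
    with i show False by simp
  qed
qed

lemma exhaust_index:
  obtains j r where "i = n j + r" "r < block_size n j"
proof -
  have "i < n (Suc i)"
    using strict_mono_imp_increasing[OF strict_mono_n, of "Suc i"] by simp
  then have ex: "\<exists>j. i < n (Suc j)" ..
  define j where "j = (LEAST j. i < n (Suc j))"
  have lt: "i < n (Suc j)"
    unfolding j_def using LeastI_ex[OF ex] .
  have "n j \<le> i"
  proof (cases j)
    case (Suc j')
    then have "\<not> i < n (Suc j')"
      using not_less_Least[of j' "\<lambda>j. i < n (Suc j)"] j_def by simp
    then show ?thesis using Suc by simp
  qed (simp add: start)
  then show thesis
    using that[of j "i - n j"] lt by (simp add: Suc_eq_add_block_size)
qed

lemma add_eq_add_iff:
  "\<lbrakk>r < block_size n p; r' < block_size n q\<rbrakk> \<Longrightarrow> n p + r = n q + r' \<longleftrightarrow> p = q \<and> r = r'"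
  by (metis block_of_add add_left_cancel)

lemma block_matrix_entry:
  "\<lbrakk>r < block_size n p; r' < block_size n q\<rbrakk>
    \<Longrightarrow> block_matrix n B (n p + r) (n q + r') = B p q $$ (r, r')"
  by (simp add: block_matrix_def block_of_add)

lemma lower_factor_entry:
  "lower_factor n l i m =
    (if i = m then 1 else if \<exists>j. i = n (Suc j) \<and> m = n j then l (block_of n i) else 0)"
proof -
  obtain p r where i: "i = n p + r" and r: "r < block_size n p" by (rule exhaust_index)
  obtain q r' where m: "m = n q + r'" and r': "r' < block_size n q" by (rule exhaust_index)
  have eq: "i = m \<longleftrightarrow> p = q \<and> r = r'"
    using add_eq_add_iff[OF r r'] i m by simp
  have pos: "0 < block_size n j" for j
    using block_size_cases[of j] by auto
  have sub: "(\<exists>j. i = n (Suc j) \<and> m = n j) \<longleftrightarrow> p = Suc q \<and> r = 0 \<and> r' = 0"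
    using add_eq_add_iff[OF r pos] add_eq_add_iff[OF r' pos] i m by auto
  have "lower_factor n l i m =
      (if p = q then 1\<^sub>m (block_size n p) else if p = q + 1 then block_L (block_size n) l p
       else 0\<^sub>m (block_size n p) (block_size n q)) $$ (r, r')"
    unfolding lower_factor_def i m by (rule block_matrix_entry[OF r r'])
  moreover have "block_of n i = p"
    unfolding i by (rule block_of_add[OF r])
  ultimately show ?thesis
    unfolding eq sub using r r' by (auto simp: block_L_def)
qed

text \<open>The upper-left entry of the diagonal block \<open>U\<^sub>j\<close>. It allows both block sizes to be
  treated alike, since the first row of every block of \<open>U\<close> has this entry on the diagonal,
  \<open>1\<close> directly to the right of it, and no other nonzero entry.\<close>

definition leading_entry :: "(nat \<Rightarrow> real) \<Rightarrow> nat \<Rightarrow> real" where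
  "leading_entry u0 j = (if block_size n j = 1 then u0 j else 0)"

lemma upper_factor_first_row:
  "upper_factor n u0 u1 (n j) m =
    (if m = n j then leading_entry u0 j else if m = n j + 1 then 1 else 0)"
proof -
  obtain q r' where m: "m = n q + r'" and r': "r' < block_size n q" by (rule exhaust_index)
  have pos: "0 < block_size n j" for j
    using block_size_cases[of j] by auto
  have eq0: "m = n j \<longleftrightarrow> q = j \<and> r' = 0"
    using add_eq_add_iff[OF r' pos, of j] m by simp
  have eq1: "m = n j + 1 \<longleftrightarrow> (if block_size n j = 1 then q = Suc j \<and> r' = 0 else q = j \<and> r' = 1)"
    using add_eq_add_iff[OF r' pos, of "Suc j"] add_eq_add_iff[OF r', of 1 j] m
      block_size_cases[of j] by (auto simp: Suc_eq_add_block_size)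
  have "upper_factor n u0 u1 (n j + 0) m =
      (if j = q then block_U (block_size n) u0 u1 j
       else if q = j + 1 then block_D (block_size n) j
       else 0\<^sub>m (block_size n j) (block_size n q)) $$ (0, r')"
    unfolding upper_factor_def m by (rule block_matrix_entry[OF pos r'])
  then show ?thesis
    unfolding eq0 eq1 using r' pos[of j] block_size_cases[of j]
    by (auto simp: block_U_def block_D_def leading_entry_def mat_of_rows_list_def less_2_cases_iff)
qed

lemma upper_factor_second_row:
  assumes "block_size n j = 2"
  shows "upper_factor n u0 u1 (n j + 1) m =
    (if m = n j then u0 j else if m = n j + 1 then u1 j else if m = n j + 2 then 1 else 0)"
proof -
  obtain q r' where m: "m = n q + r'" and r': "r' < block_size n q" by (rule exhaust_index)
  have pos: "0 < block_size n j" for j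
    using block_size_cases[of j] by auto
  have one: "1 < block_size n j" using assms by simp
  have eq0: "m = n j \<longleftrightarrow> q = j \<and> r' = 0"
    using add_eq_add_iff[OF r' pos, of j] m by simp
  have eq1: "m = n j + 1 \<longleftrightarrow> q = j \<and> r' = 1"
    using add_eq_add_iff[OF r' one] m by simp
  have eq2: "m = n j + 2 \<longleftrightarrow> q = Suc j \<and> r' = 0"
    using add_eq_add_iff[OF r' pos, of "Suc j"] m assms by (simp add: Suc_eq_add_block_size)
  have "upper_factor n u0 u1 (n j + 1) m =
      (if j = q then block_U (block_size n) u0 u1 j
       else if q = j + 1 then block_D (block_size n) j
       else 0\<^sub>m (block_size n j) (block_size n q)) $$ (1, r')"
    unfolding upper_factor_def m by (rule block_matrix_entry[OF one r'])
  then show ?thesis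
    unfolding eq0 eq1 eq2 using r' assms
    by (auto simp: block_U_def block_D_def mat_of_rows_list_def less_2_cases_iff)
qed

lemma inf_mat_mult_lower_row:
  assumes "\<nexists>j. i = n (Suc j)"
  shows "inf_mat_mult (lower_factor n l) U i m = U i m"
proof -
  have "lower_factor n l i r * U r m = (if r = i then U i m else 0)" for r
    using assms by (auto simp: lower_factor_entry)
  then show ?thesis
    by (simp add: inf_mat_mult_def)
qed

lemma inf_mat_mult_lower_row_Suc:
  "inf_mat_mult (lower_factor n l) U (n (Suc j)) m =
    U (n (Suc j)) m + l (Suc j) * U (n j) m"
proof -
  have block: "block_of n (n (Suc j)) = Suc j"
    using block_of_add[of 0 "Suc j"] block_size_cases[of "Suc j"] by fastforce
  have inj: "n (Suc j) = n (Suc j') \<longleftrightarrow> j = j'" for j'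
    using strict_mono_n by (simp add: strict_mono_eq)
  have "lower_factor n l (n (Suc j)) r = (if r = n (Suc j) then 1 else if r = n j then l (Suc j) else 0)" for r
    by (auto simp: lower_factor_entry block inj)
  then have entry: "lower_factor n l (n (Suc j)) r * U r m =
      (if r = n (Suc j) then U r m else if r = n j then l (Suc j) * U r m else 0)" for r
    by simp
  show ?thesis
    unfolding inf_mat_mult_def entry
    using less_Suc[of j]
    by (subst Sum_any.expand_superset[of "{n j, n (Suc j)}"]) auto
qed

text \<open>Comparing the rows \<open>0\<close>, the first rows of the later blocks, and the second rows of the
  blocks of size \<open>2\<close> turns \<open>J = L U\<close> into scalar equations.\<close>

lemma jacobi_eq_mult_iff:
  "monic_jacobi_matrix b c = inf_mat_mult (lower_factor n l) (upper_factor n u0 u1) \<longleftrightarrow>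
    b 0 = leading_entry u0 0 \<and>
    (\<forall>j. if block_size n j = 1
         then c (n j) = l (Suc j) * u0 j \<and> b (n (Suc j)) = leading_entry u0 (Suc j) + l (Suc j)
         else c (n j + 1) = l (Suc j) \<and> b (n (Suc j)) = leading_entry u0 (Suc j) \<and>
              u0 j = c (n j) \<and> u1 j = b (n j + 1))"
  (is "?J = inf_mat_mult ?L ?U \<longleftrightarrow> ?R")
proof -
  have row0: "(\<forall>m. ?J 0 m = inf_mat_mult ?L ?U 0 m) \<longleftrightarrow> b 0 = leading_entry u0 0"
  proof -
    have "\<nexists>j. 0 = n (Suc j)"
      using less_Suc by (metis not_less_zero)
    then have "inf_mat_mult ?L ?U 0 m =
        (if m = 0 then leading_entry u0 0 else if m = 1 then 1 else 0)" for m
      using inf_mat_mult_lower_row[of 0] upper_factor_first_row[of u0 u1 0] by (simp add: start)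
    then show ?thesis by (auto simp: monic_jacobi_matrix_def)
  qed
  have row1: "(\<forall>m. ?J (n (Suc j)) m = inf_mat_mult ?L ?U (n (Suc j)) m) \<longleftrightarrow>
      (if block_size n j = 1
       then c (n j) = l (Suc j) * u0 j \<and> b (n (Suc j)) = leading_entry u0 (Suc j) + l (Suc j)
       else c (n j + 1) = l (Suc j) \<and> b (n (Suc j)) = leading_entry u0 (Suc j))" for j
  proof (cases "block_size n j = 1")
    case True
    then have nj: "n (Suc j) = n j + 1" by (simp add: Suc_eq_add_block_size)
    have row: "inf_mat_mult ?L ?U (n (Suc j)) m =
        (if m = n j then l (Suc j) * u0 j
         else if m = Suc (n j) then leading_entry u0 (Suc j) + l (Suc j)
         else if m = Suc (Suc (n j)) then 1 else 0)" for m
      unfolding inf_mat_mult_lower_row_Suc upper_factor_first_row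
      unfolding nj
      using True by (auto simp: leading_entry_def)
    show ?thesis
      unfolding row using True monic_jacobi_row_eq_iff[of b c "n j"] by (simp add: nj)
  next
    case False
    then have nj: "n (Suc j) = n j + 2"
      using block_size_cases[of j] by (simp add: Suc_eq_add_block_size)
    have row: "inf_mat_mult ?L ?U (n (Suc j)) m =
        (if m = Suc (n j) then l (Suc j) else if m = Suc (Suc (n j)) then leading_entry u0 (Suc j)
         else if m = Suc (Suc (Suc (n j))) then 1 else 0)" for m
      unfolding inf_mat_mult_lower_row_Suc upper_factor_first_row
      unfolding nj
      using False by (auto simp: leading_entry_def)
    show ?thesis
      unfolding row using False monic_jacobi_row_eq_iff[of b c "Suc (n j)"] by (simp add: nj)
  qed
  have row2: "(\<forall>m. ?J (n j + 1) m = inf_mat_mult ?L ?U (n j + 1) m) \<longleftrightarrow>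
      u0 j = c (n j) \<and> u1 j = b (n j + 1)" if two: "block_size n j = 2" for j
  proof -
    have "n j + 1 \<noteq> n (Suc i)" for i
      using add_eq_add_iff[of 1 j 0 "Suc i"] two block_size_cases[of "Suc i"] by auto
    then have "\<nexists>i. n j + 1 = n (Suc i)" by blast
    then have row: "inf_mat_mult ?L ?U (Suc (n j)) m =
        (if m = n j then u0 j else if m = Suc (n j) then u1 j else if m = Suc (Suc (n j)) then 1 else 0)" for m
      using inf_mat_mult_lower_row upper_factor_second_row[OF two] by simp
    show ?thesis
      using monic_jacobi_row_eq_iff[of b c "n j"] by (auto simp: row)
  qed
  have rows: "(\<forall>i. Q i) \<longleftrightarrow> Q 0 \<and> (\<forall>j. Q (n (Suc j))) \<and> (\<forall>j. block_size n j = 2 \<longrightarrow> Q (n j + 1))"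
    for Q :: "nat \<Rightarrow> bool"
  proof
    assume R: "Q 0 \<and> (\<forall>j. Q (n (Suc j))) \<and> (\<forall>j. block_size n j = 2 \<longrightarrow> Q (n j + 1))"
    show "\<forall>i. Q i"
    proof
      fix i
      obtain j r where ir: "i = n j + r" "r < block_size n j" by (rule exhaust_index)
      show "Q i"
      proof (cases "r = 0")
        case True
        then show ?thesis using R ir start by (cases j) auto
      next
        case False
        then have "r = 1 \<and> block_size n j = 2" using ir block_size_cases[of j] by auto
        then show ?thesis using R ir by auto
      qed
    qed
  qed blast
  have "?J = inf_mat_mult ?L ?U \<longleftrightarrow> (\<forall>i m. ?J i m = inf_mat_mult ?L ?U i m)"
    by (auto simp: fun_eq_iff)
  also have "\<dots> \<longleftrightarrow> b 0 = leading_entry u0 0 \<and>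
      (\<forall>j. if block_size n j = 1
       then c (n j) = l (Suc j) * u0 j \<and> b (n (Suc j)) = leading_entry u0 (Suc j) + l (Suc j)
       else c (n j + 1) = l (Suc j) \<and> b (n (Suc j)) = leading_entry u0 (Suc j)) \<and>
      (\<forall>j. block_size n j = 2 \<longrightarrow> u0 j = c (n j) \<and> u1 j = b (n j + 1))"
    unfolding rows[where Q = "\<lambda>i. \<forall>m. ?J i m = inf_mat_mult ?L ?U i m"] row0 row1
    using row2 by (simp cong: imp_cong)
  also have "\<dots> \<longleftrightarrow> ?R"
  proof -
    have "block_size n j = 2 \<longleftrightarrow> block_size n j \<noteq> 1" for j
      using block_size_cases[of j] by auto
    then show ?thesis by auto
  qed
  finally show ?thesis .
qed

lemma lower_factor_cong: "(\<And>j. l (Suc j) = l' (Suc j)) \<Longrightarrow> lower_factor n l = lower_factor n l'"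
proof (intro ext)
  fix i m assume eq: "\<And>j. l (Suc j) = l' (Suc j)"
  have "block_of n (n (Suc j)) = Suc j" for j
    using block_of_add[of 0 "Suc j"] block_size_cases[of "Suc j"] by fastforce
  then show "lower_factor n l i m = lower_factor n l' i m"
    using eq by (auto simp: lower_factor_entry)
qed

lemma upper_factor_cong:
  assumes "\<And>j. u0 j = v0 j" and "\<And>j. block_size n j = 2 \<Longrightarrow> u1 j = v1 j"
  shows "upper_factor n u0 u1 = upper_factor n v0 v1"
proof -
  have "block_U (block_size n) u0 u1 j = block_U (block_size n) v0 v1 j" for j
    using assms block_size_cases[of j] by (auto simp: block_U_def)
  then show ?thesis by (simp add: upper_factor_def cong: if_cong)
qed

end

text \<open>The blocks follow the zeros of a solution \<open>a\<close> of the three-term recurrence, as it is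
  satisfied by \<open>a i = P\<^sub>i(0)\<close>: the index \<open>n j\<close> runs through the places with \<open>a i \<noteq> 0\<close>, and the
  second index of a block of size \<open>2\<close> is a zero of \<open>a\<close>.\<close>

locale jacobi_block_partition = block_partition +
  fixes a b c :: "nat \<Rightarrow> real"
  assumes a_0: "a 0 = 1"
    and a_1: "a 1 = - b 0"
    and a_rec: "\<And>i. a (i + 2) = - b (i + 1) * a (i + 1) - c i * a i"
    and c_nonzero: "\<And>i. c i \<noteq> 0"
    and a_nonzero: "\<And>j. a (n j) \<noteq> 0"
    and a_zero: "\<And>j. block_size n j = 2 \<Longrightarrow> a (n j + 1) = 0"
begin

text \<open>The coefficients \<open>l\<^sub>j\<close>, \<open>j \<ge> 1\<close>, and \<open>u\<^sub>0\<^sup>(\<^sup>j\<^sup>)\<close> of the two factors.\<close>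

definition lower_coeff :: "nat \<Rightarrow> real" where
  "lower_coeff j = (if block_size n (j - 1) = 1 then - c (n (j - 1)) * a (n (j - 1)) / a (n j)
    else c (n j - 1))"

definition upper_coeff :: "nat \<Rightarrow> real" where
  "upper_coeff j = - (a (n (Suc j)) / a (n j))"

text \<open>For a block of size \<open>2\<close> both sides vanish.\<close>

lemma leading_entry_upper_coeff: "leading_entry upper_coeff j = - (a (n j + 1) / a (n j))"
  using a_zero[of j] block_size_cases[of j]
  by (auto simp: leading_entry_def upper_coeff_def Suc_eq_add_block_size)

lemma upper_coeff_two: "block_size n j = 2 \<Longrightarrow> upper_coeff j = c (n j)"
  using a_rec[of "n j"] a_zero[of j] a_nonzero[of j]
  by (simp add: upper_coeff_def Suc_eq_add_block_size)

text \<open>The scalar equations have exactly one solution. Row by row, they determine the leading entry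
  of each block from the previous one, as \<open>- a (n j + 1) / a (n j)\<close>. The passage from a block of size
  \<open>1\<close> divides by its leading entry, which is nonzero because \<open>a (n (j + 1)) \<noteq> 0\<close>; a block of size
  \<open>2\<close> reads \<open>u\<^sub>0\<^sup>(\<^sup>j\<^sup>)\<close> and \<open>l\<^sub>j\<^sub>+\<^sub>1\<close> off the matrix directly.\<close>

lemma jacobi_eq_mult_iff_coeffs:
  "monic_jacobi_matrix b c = inf_mat_mult (lower_factor n l) (upper_factor n u0 u1) \<longleftrightarrow>
    (\<forall>j. l (Suc j) = lower_coeff (Suc j) \<and> u0 j = upper_coeff j \<and>
         (block_size n j = 2 \<longrightarrow> u1 j = b (n j + 1)))"
  (is "?fac \<longleftrightarrow> ?coeffs")
proof
  assume ?coeffs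
  then have l: "\<And>j. l (Suc j) = lower_coeff (Suc j)" and u0: "u0 = upper_coeff"
    and u1: "\<And>j. block_size n j = 2 \<Longrightarrow> u1 j = b (n j + 1)" by auto
  show ?fac
    unfolding jacobi_eq_mult_iff u0 leading_entry_upper_coeff l
  proof (intro conjI allI)
    show "b 0 = - (a (n 0 + 1) / a (n 0))"
      using a_0 a_1 by (simp add: start)
    fix j
    show "if block_size n j = 1
      then c (n j) = lower_coeff (Suc j) * upper_coeff j \<and>
        b (n (Suc j)) = - (a (n (Suc j) + 1) / a (n (Suc j))) + lower_coeff (Suc j)
      else c (n j + 1) = lower_coeff (Suc j) \<and>
        b (n (Suc j)) = - (a (n (Suc j) + 1) / a (n (Suc j))) \<and>
        upper_coeff j = c (n j) \<and> u1 j = b (n j + 1)"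
    proof (cases "block_size n j = 1")
      case True
      then show ?thesis
        using a_rec[of "n j"] a_nonzero[of j] a_nonzero[of "Suc j"]
        by (simp add: lower_coeff_def upper_coeff_def Suc_eq_add_block_size field_simps)
    next
      case False
      then have two: "block_size n j = 2" using block_size_cases[of j] by simp
      then show ?thesis
        using a_rec[of "n j + 1"] a_nonzero[of "Suc j"] a_zero[OF two] upper_coeff_two[OF two] u1[OF two]
        by (simp add: lower_coeff_def Suc_eq_add_block_size field_simps numeral_3_eq_3)
    qed
  qed
next
  assume ?fac
  then have b_0: "b 0 = leading_entry u0 0"
    and blocks: "\<And>j. if block_size n j = 1
       then c (n j) = l (Suc j) * u0 j \<and> b (n (Suc j)) = leading_entry u0 (Suc j) + l (Suc j)
       else c (n j + 1) = l (Suc j) \<and> b (n (Suc j)) = leading_entry u0 (Suc j) \<and>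
            u0 j = c (n j) \<and> u1 j = b (n j + 1)"
    unfolding jacobi_eq_mult_iff by blast+
  have one: "c (n j) = l (Suc j) * u0 j" "b (n (Suc j)) = leading_entry u0 (Suc j) + l (Suc j)"
    if "block_size n j = 1" for j
    using blocks[of j] that by simp_all
  have two: "c (n j + 1) = l (Suc j)" "b (n (Suc j)) = leading_entry u0 (Suc j)"
    "u0 j = c (n j)" "u1 j = b (n j + 1)" if "block_size n j = 2" for j
    using blocks[of j] that by simp_all
  have u0_if: "u0 j = upper_coeff j" if "leading_entry u0 j = leading_entry upper_coeff j" for j
    using that two(3)[of j] upper_coeff_two[of j] block_size_cases[of j]
    by (auto simp: leading_entry_def)
  have l_one: "l (Suc j) = lower_coeff (Suc j)"
    if "block_size n j = 1" "u0 j = upper_coeff j" for j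
    using one(1)[OF that(1)] that a_nonzero[of j] a_nonzero[of "Suc j"]
    by (simp add: lower_coeff_def upper_coeff_def field_simps)
  have l_two: "l (Suc j) = lower_coeff (Suc j)" if "block_size n j = 2" for j
    using two(1)[OF that] that by (simp add: lower_coeff_def Suc_eq_add_block_size)
  have lead: "leading_entry u0 j = leading_entry upper_coeff j" for j
  proof (induction j)
    case 0
    show ?case
      using b_0 a_0 a_1 unfolding leading_entry_upper_coeff by (simp add: start)
  next
    case (Suc j)
    show ?case
    proof (cases "block_size n j = 1")
      case True
      have "b (n (Suc j)) = leading_entry u0 (Suc j) + lower_coeff (Suc j)"
        using one(2)[OF True] l_one[OF True u0_if[OF Suc.IH]] by simp
      then show ?thesis
        using a_rec[of "n j"] a_nonzero[of j] a_nonzero[of "Suc j"] True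
        unfolding leading_entry_upper_coeff
        by (simp add: lower_coeff_def Suc_eq_add_block_size field_simps)
    next
      case False
      then have two': "block_size n j = 2" using block_size_cases[of j] by simp
      then show ?thesis
        using two(2)[OF two'] a_rec[of "n j + 1"] a_nonzero[of "Suc j"] a_zero[OF two']
        unfolding leading_entry_upper_coeff
        by (simp add: Suc_eq_add_block_size field_simps numeral_3_eq_3)
    qed
  qed
  show ?coeffs
  proof (intro allI conjI impI)
    fix j
    show "u0 j = upper_coeff j"
      by (rule u0_if[OF lead])
    then show "l (Suc j) = lower_coeff (Suc j)"
      using l_one l_two block_size_cases[of j] by blast
    show "u1 j = b (n j + 1)" if "block_size n j = 2"
      by (rule two(4)[OF that])
  qed
qed

theorem exists_unique_factorization:
  "\<exists>!(L, U). (\<exists>l. L = lower_factor n l) \<and> (\<exists>u0 u1. U = upper_factor n u0 u1) \<and>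
     monic_jacobi_matrix b c = inf_mat_mult L U"
proof (rule ex1I[of _ "(lower_factor n lower_coeff, upper_factor n upper_coeff (\<lambda>j. b (n j + 1)))"])
  show "case (lower_factor n lower_coeff, upper_factor n upper_coeff (\<lambda>j. b (n j + 1))) of
      (L, U) \<Rightarrow> (\<exists>l. L = lower_factor n l) \<and> (\<exists>u0 u1. U = upper_factor n u0 u1) \<and>
        monic_jacobi_matrix b c = inf_mat_mult L U"
    using jacobi_eq_mult_iff_coeffs by auto
  fix LU assume "case LU of (L, U) \<Rightarrow> (\<exists>l. L = lower_factor n l) \<and>
    (\<exists>u0 u1. U = upper_factor n u0 u1) \<and> monic_jacobi_matrix b c = inf_mat_mult L U"
  then obtain l u0 u1 where LU: "LU = (lower_factor n l, upper_factor n u0 u1)"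
    and "monic_jacobi_matrix b c = inf_mat_mult (lower_factor n l) (upper_factor n u0 u1)"
    by auto
  then have coeffs: "\<And>j. l (Suc j) = lower_coeff (Suc j)" "\<And>j. u0 j = upper_coeff j"
    "\<And>j. block_size n j = 2 \<Longrightarrow> u1 j = b (n j + 1)"
    unfolding jacobi_eq_mult_iff_coeffs by blast+
  have "lower_factor n l = lower_factor n lower_coeff"
    by (rule lower_factor_cong) (rule coeffs)
  moreover have "upper_factor n u0 u1 = upper_factor n upper_coeff (\<lambda>j. b (n j + 1))"
    by (rule upper_factor_cong) (fact coeffs)+
  ultimately show "LU = (lower_factor n lower_coeff, upper_factor n upper_coeff (\<lambda>j. b (n j + 1)))"
    unfolding LU by simp
qed

end

section \<open>Normal indices and the factorization of the Jacobi matrix\<close>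

text \<open>If the normal indices are the places where a sequence without two consecutive zeros does not
  vanish, then they advance by \<open>1\<close> or \<open>2\<close>.\<close>

lemma normal_index_of_nonzero:
  fixes a :: "nat \<Rightarrow> real"
  assumes S: "normal_indices s = {m. m \<ge> 1 \<and> a m \<noteq> 0}"
    and no_two: "\<And>m. a m = 0 \<Longrightarrow> a (Suc m) \<noteq> 0"
    and a_0: "a 0 \<noteq> 0"
  shows "normal_index s (Suc j) = (if a (normal_index s j + 1) \<noteq> 0 then normal_index s j + 1
      else normal_index s j + 2)"
    and "a (normal_index s j) \<noteq> 0"
proof -
  let ?n = "normal_index s"
  have inf: "infinite (normal_indices s)"
    unfolding infinite_nat_iff_unbounded S
  proof
    fix m
    show "\<exists>k>m. k \<in> {m. 1 \<le> m \<and> a m \<noteq> 0}"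
    proof (cases "a (Suc m) = 0")
      case True
      then show ?thesis
        using no_two[of "Suc m"] by (intro exI[of _ "Suc (Suc m)"]) simp
    next
      case False
      then show ?thesis
        by (intro exI[of _ "Suc m"]) simp
    qed
  qed
  have "?n (Suc j) = (LEAST m. m \<in> normal_indices s \<and> ?n j < m)"
  proof (cases j)
    case 0
    have "m \<in> normal_indices s \<longleftrightarrow> m \<in> normal_indices s \<and> 0 < m" for m
      by (auto simp: S)
    then show ?thesis by (simp add: 0 normal_index_def enumerate_0)
  qed (simp add: normal_index_def enumerate_Suc''[OF inf])
  also have "\<dots> = (if a (?n j + 1) \<noteq> 0 then ?n j + 1 else ?n j + 2)"
  proof (rule Least_equality)
    show "(if a (?n j + 1) \<noteq> 0 then ?n j + 1 else ?n j + 2) \<in> normal_indices s \<and>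
        ?n j < (if a (?n j + 1) \<noteq> 0 then ?n j + 1 else ?n j + 2)"
      using no_two[of "?n j + 1"] by (auto simp: S)
    fix m assume "m \<in> normal_indices s \<and> ?n j < m"
    then have "a m \<noteq> 0" "m \<ge> ?n j + 1" by (auto simp: S)
    then show "(if a (?n j + 1) \<noteq> 0 then ?n j + 1 else ?n j + 2) \<le> m"
      by (cases "m = ?n j + 1") auto
  qed
  finally show "?n (Suc j) = (if a (?n j + 1) \<noteq> 0 then ?n j + 1 else ?n j + 2)" .
  show "a (?n j) \<noteq> 0"
  proof (cases j)
    case (Suc i)
    then show ?thesis
      using enumerate_in_set[OF inf, of i] by (simp add: normal_index_def S)
  qed (simp add: normal_index_def a_0)
qed

theorem proposition3p1:
  fixes F :: "complex \<Rightarrow> complex" and s b c :: "nat \<Rightarrow> real" and \<sigma> :: "real measure"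
    and P :: "nat \<Rightarrow> real poly" and J :: inf_mat and n k :: "nat \<Rightarrow> nat"
  assumes "F \<in> nevanlinna_minus_infinity"
    and "asymptotic_coeffs F s"
    and "stieltjes_measure_of F \<sigma>"
    and nonrational: "infinite (measure_support \<sigma>)"
    and "monic_orthogonal_polys (scale_measure (ennreal (1 / s 0)) \<sigma>) P"
    and "three_term_recurrence P b c"
    and "J = monic_jacobi_matrix b c"
    and "n = normal_index (\<lambda>j. s (j+1))"
    and "k = block_size n"
  shows "(\<exists>!(L, U). (\<exists>l. L = lower_factor n l) \<and> (\<exists>u0 u1. U = upper_factor n u0 u1) \<and>
            J = inf_mat_mult L U) \<and>
         (\<forall>l u0 u1. J = inf_mat_mult (lower_factor n l) (upper_factor n u0 u1) \<longrightarrow>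
            (\<forall>j. u0 j = - (poly (P (n (j+1))) 0 / poly (P (n j)) 0) \<and>
                 (k j = 2 \<longrightarrow> u1 j = b (n j + 1))))"
proof -
  note F = \<open>stieltjes_measure_of F \<sigma>\<close> and rec = \<open>three_term_recurrence P b c\<close>
  interpret moment_measure \<sigma>
    using F nonrational by unfold_locales (auto simp: stieltjes_measure_of_def)
  have moments: "s = (\<lambda>j. \<integral>t. t ^ j \<partial>\<sigma>)"
    using asymptotic_coeffs_eq_moments[OF F \<open>asymptotic_coeffs F s\<close>] by blast
  have s_0: "s 0 > 0"
    using mean_square_pos[of 1] by (simp add: moments mean_def)
  note polys = \<open>monic_orthogonal_polys _ P\<close>[unfolded monic_orthogonal_polys_def]
  interpret monic_orthogonal \<sigma> P
  proof
    show "degree (P j) = j" "lead_coeff (P j) = 1" for j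
      using polys by blast+
    fix i j :: nat assume "i \<noteq> j"
    then have "(\<integral>t. poly (P i * P j) t \<partial>scale_measure (ennreal (1 / s 0)) \<sigma>) = 0"
      using polys by simp
    then show "mean (P i * P j) = 0"
      using s_0 by (subst (asm) integral_scale_measure) (auto simp: borel_measurable_poly mean_def simp del: poly_mult)
  qed
  define a where "a i = poly (P i) 0" for i
  have a_0: "a 0 = 1"
    using coeff_P[of 0] by (simp add: a_def poly_0_coeff_0)
  have a_1: "a 1 = - b 0"
    using arg_cong[OF rec[unfolded three_term_recurrence_def, rule_format, of 0], of "\<lambda>p. poly p 0"] a_0
    by (simp add: a_def)
  have a_rec: "a (i + 2) = - b (i + 1) * a (i + 1) - c i * a i" for i
    using arg_cong[OF rec[unfolded three_term_recurrence_def, rule_format, of "i + 1"], of "\<lambda>p. poly p 0"]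
    by (simp add: a_def)
  have c: "c i \<noteq> 0" for i
    using recurrence_coeff_pos[OF rec, of i] by simp
  \<comment> \<open>By the recurrence, two consecutive zeros would propagate down to \<open>a 0 = 1\<close>.\<close>
  have no_two: "a (Suc m) \<noteq> 0" if "a m = 0" for m
    using that
  proof (induction m)
    case (Suc m)
    then show ?case using a_rec[of m] c[of m] by auto
  qed (simp add: a_0)
  have indices: "normal_indices (\<lambda>j. s (j + 1)) = {m. m \<ge> 1 \<and> a m \<noteq> 0}"
    using hankel_det_shifted_eq_0_iff by (simp add: normal_indices_def moments a_def)
  have n_Suc: "n (Suc j) = (if a (n j + 1) \<noteq> 0 then n j + 1 else n j + 2)"
    and a_n: "a (n j) \<noteq> 0" for j
    using normal_index_of_nonzero[where a = a, OF indices no_two] a_0 unfolding \<open>n = _\<close> by simp_all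
  interpret jacobi_block_partition n a b c
  proof
    show "n 0 = 0" by (simp add: \<open>n = _\<close> normal_index_def)
    show "n (Suc j) = n j + 1 \<or> n (Suc j) = n j + 2" for j
      using n_Suc[of j] by simp
    show "a (n j + 1) = 0" if "block_size n j = 2" for j
      using that n_Suc[of j] by (auto simp: block_size_def split: if_splits)
  qed (fact a_0 a_1 a_rec c a_n)+
  show ?thesis
    using exists_unique_factorization jacobi_eq_mult_iff_coeffs
    unfolding \<open>J = _\<close> \<open>k = _\<close> by (simp add: upper_coeff_def a_def)
qed

end
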